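(* Let $k\ge 3$ be an integer and let $H$ be a subgraph of the star $K_{1,k}$. Then $$\operatorname{bgr}_k(P_4:H)=\lceil \sqrt{k}\rceil.$$
   Context: All graphs are finite, simple and without isolated vertices (in particular $H$ is non-empty). $P_n$ is the path on $n$ vertices. A $k$-edge-coloring of a graph is a map from its edge set onto $\{1,\dots,k\}$ that is exact, i.e. every one of the $k$ colors is used at least once. An edge-colored graph is rainbow if all its edges have distinct colors and monochromatic if all its edges have the same color. For non-empty bipartite graphs $G,H$ and a positive integer $k$, the bipartite Gallai-Ramsey number $\operatorname{bgr}_k(G:H)$ is the minimum integer $N$ such that for all $n\ge N$, every (exact) $k$-edge-coloring of the complete bipartite graph $K_{n,n}$ contains a rainbow subgraph isomorphic to $G$ or a monochromatic subgraph isomorphic to $H$.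
   Formalization: In the definition of bgr_k, the minimum is taken only over those N for which K_{N,N} has an exact k-edge-coloring (i.e. k ≤ N²); without this restriction the property holds vacuously for smaller N and the stated value would be false. *)

theory Defs
  imports Complex_Main "HOL-Library.Extended_Nat"
begin

datatype 'v graph = Graph (verts: "'v set") (edges: "'v set set")

definition simple_graph :: "'v graph \<Rightarrow> bool" where
  "simple_graph G \<longleftrightarrow> finite (verts G) \<and> edges G \<subseteq> {e. e \<subseteq> verts G \<and> card e = 2}"

definition no_isolated :: "'v graph \<Rightarrow> bool" where
  "no_isolated G \<longleftrightarrow> verts G \<subseteq> \<Union> (edges G)"

definition subgraph :: "'v graph \<Rightarrow> 'v graph \<Rightarrow> bool" where
  "subgraph S G \<longleftrightarrow> simple_graph S \<and> verts S \<subseteq> verts G \<and> edges S \<subseteq> edges G"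

definition isomorphic :: "'v graph \<Rightarrow> 'w graph \<Rightarrow> bool" where
  "isomorphic G H \<longleftrightarrow>
     (\<exists>f. bij_betw f (verts G) (verts H) \<and> (\<lambda>e. f ` e) ` edges G = edges H)"

definition path_graph :: "nat \<Rightarrow> nat graph" where
  "path_graph n = Graph {..<n} {{i, Suc i} |i. Suc i < n}"

definition complete_bipartite :: "nat \<Rightarrow> nat \<Rightarrow> (nat + nat) graph" where
  "complete_bipartite m n =
     Graph (Inl ` {..<m} \<union> Inr ` {..<n}) {{Inl i, Inr j} |i j. i < m \<and> j < n}"

text \<open>A coloring is a total function on sets of vertices; only its values on the edges matter.\<close>

definition exact_edge_coloring :: "nat \<Rightarrow> 'v graph \<Rightarrow> ('v set \<Rightarrow> nat) \<Rightarrow> bool" where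
  "exact_edge_coloring k G c \<longleftrightarrow> c ` edges G = {1..k}"

definition rainbow :: "('v set \<Rightarrow> nat) \<Rightarrow> 'v graph \<Rightarrow> bool" where
  "rainbow c G \<longleftrightarrow> inj_on c (edges G)"

definition monochromatic :: "('v set \<Rightarrow> nat) \<Rightarrow> 'v graph \<Rightarrow> bool" where
  "monochromatic c G \<longleftrightarrow> (\<exists>a. \<forall>e \<in> edges G. c e = a)"

definition gallai_ramsey_property :: "nat \<Rightarrow> 'g graph \<Rightarrow> 'h graph \<Rightarrow> nat \<Rightarrow> bool" where
  "gallai_ramsey_property k G H n \<longleftrightarrow>
     (\<forall>c. exact_edge_coloring k (complete_bipartite n n) c \<longrightarrow>
        (\<exists>S. subgraph S (complete_bipartite n n) \<and> isomorphic S G \<and> rainbow c S) \<or>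
        (\<exists>S. subgraph S (complete_bipartite n n) \<and> isomorphic S H \<and> monochromatic c S))"

text \<open>
  The candidates \<open>N\<close> are restricted to those for which \<open>K\<^sub>N\<^sub>,\<^sub>N\<close> has an exact \<open>k\<close>-edge-coloring
  at all, i.e. (for \<open>k \<ge> 1\<close>) to \<open>k \<le> N\<^sup>2\<close>, the usual convention for bipartite Gallai-Ramsey numbers. Without it
  the property holds vacuously for all smaller \<open>N\<close>, and those would compete for the minimum.
  The value is \<open>\<infinity>\<close> if no candidate works.
\<close>

definition bgr :: "nat \<Rightarrow> 'g graph \<Rightarrow> 'h graph \<Rightarrow> enat" where
  "bgr k G H = Inf (enat ` {N.
     (\<exists>c. exact_edge_coloring k (complete_bipartite N N) c) \<and>
     (\<forall>n \<ge> N. gallai_ramsey_property k G H n)})"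

end

theory Submission
  imports Defs
begin

text \<open>
  View a coloring of \<open>K\<^sub>n\<^sub>,\<^sub>n\<close> as an \<open>n \<times> n\<close> matrix. As the ends of a \<open>P\<^sub>4\<close> are adjacent, there is no rainbow
  \<open>P\<^sub>4\<close> iff every \<open>2 \<times> 2\<close> submatrix has at most two distinct entries. If in addition at least three
  colors occur, then all rows or all columns are constant. Hence an exact \<open>k\<close>-coloring without
  rainbow \<open>P\<^sub>4\<close> has \<open>n \<ge> k\<close> and a monochromatic \<open>K\<^sub>1\<^sub>,\<^sub>n\<close>, so the Ramsey property holds for every \<open>n\<close>,
  and only the condition \<open>k \<le> N\<^sup>2\<close> for the existence of an exact coloring matters.
\<close>

text \<open>Copies of a pattern inside \<open>K\<^sub>n\<^sub>,\<^sub>n\<close> are exhibited as its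
  images under injective vertex maps.\<close>

definition graph_image :: "('v \<Rightarrow> 'w) \<Rightarrow> 'v graph \<Rightarrow> 'w graph" where
  "graph_image f G = Graph (f ` verts G) ((`) f ` edges G)"

lemma verts_graph_image [simp]: "verts (graph_image f G) = f ` verts G"
  and edges_graph_image [simp]: "edges (graph_image f G) = (`) f ` edges G"
  by (simp_all add: graph_image_def)

lemma isomorphic_graph_image:
  assumes "simple_graph G" "inj_on f (verts G)"
  shows "isomorphic (graph_image f G) G"
  unfolding isomorphic_def
proof (intro exI conjI)
  show "bij_betw (inv_into (verts G) f) (verts (graph_image f G)) (verts G)"
    using assms(2) by (simp add: bij_betw_inv_into inj_on_imp_bij_betw)
  have "inv_into (verts G) f ` f ` e = e" if "e \<in> edges G" for e
    using assms that by (intro inv_into_image_cancel) (auto simp: simple_graph_def)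
  then show "(`) (inv_into (verts G) f) ` edges (graph_image f G) = edges G"
    by (simp add: image_image)
qed

lemma isomorphic_trans:
  assumes "isomorphic G H" "isomorphic H K"
  shows "isomorphic G K"
proof -
  obtain f where f: "bij_betw f (verts G) (verts H)" "(`) f ` edges G = edges H"
    using assms(1) by (auto simp: isomorphic_def)
  obtain g where g: "bij_betw g (verts H) (verts K)" "(`) g ` edges H = edges K"
    using assms(2) by (auto simp: isomorphic_def)
  have "bij_betw (g \<circ> f) (verts G) (verts K)"
    using f(1) g(1) by (rule bij_betw_trans)
  moreover have "(`) (g \<circ> f) ` edges G = edges K"
    unfolding g(2)[symmetric] f(2)[symmetric] by (simp add: image_image image_comp)
  ultimately show ?thesis
    unfolding isomorphic_def by blast
qed

lemma simple_graph_image: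
  assumes "simple_graph G" "inj_on f (verts G)"
  shows "simple_graph (graph_image f G)"
  using assms by (fastforce simp: simple_graph_def card_image inj_on_subset)

lemma simple_graph_path_graph: "simple_graph (path_graph n)"
  by (auto simp: simple_graph_def path_graph_def)

lemma edges_path_graph_4: "edges (path_graph 4) = {{0, 1}, {1, 2}, {2, 3}}"
proof -
  have "Suc i < 4 \<longleftrightarrow> i = 0 \<or> i = 1 \<or> i = 2" for i
    by auto
  then show ?thesis
    by (auto simp: path_graph_def numeral_eq_Suc)
qed

text \<open>The path visits \<open>Inl i\<close>, \<open>Inr j\<close>, \<open>Inl i'\<close>,
  \<open>Inr j'\<close> in this order, so its edges are three entries of a 2 \<times> 2 submatrix.
  Exchanging \<open>i\<close> with \<open>i'\<close> or \<open>j\<close> with \<open>j'\<close>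
  reaches every choice of three of the four entries.\<close>

lemma rainbow_path_graph_4:
  fixes c :: "(nat + nat) set \<Rightarrow> nat"
  assumes "i < n" "i' < n" "j < n" "j' < n" "i \<noteq> i'" "j \<noteq> j'"
    and "distinct [c {Inl i, Inr j}, c {Inl i', Inr j}, c {Inl i', Inr j'}]"
  shows "\<exists>S. subgraph S (complete_bipartite n n) \<and> isomorphic S (path_graph 4) \<and> rainbow c S"
proof (intro exI conjI)
  define p :: "nat \<Rightarrow> nat + nat" where "p = (!) [Inl i, Inr j, Inl i', Inr j']"
  have p: "p 0 = Inl i" "p 1 = Inr j" "p 2 = Inl i'" "p 3 = Inr j'"
    by (simp_all add: p_def numeral_eq_Suc)
  have V: "verts (path_graph 4) = {0, 1, 2, 3}"
    by (auto simp: path_graph_def)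
  have inj: "inj_on p (verts (path_graph 4))"
    unfolding V using assms p by (simp add: inj_on_def)
  let ?S = "graph_image p (path_graph 4)"
  show "isomorphic ?S (path_graph 4)"
    by (rule isomorphic_graph_image[OF simple_graph_path_graph inj])
  have E: "edges ?S = {{Inl i, Inr j}, {Inl i', Inr j}, {Inl i', Inr j'}}"
    unfolding edges_graph_image edges_path_graph_4 by (simp only: image_insert image_empty p) blast
  show "subgraph ?S (complete_bipartite n n)"
    unfolding subgraph_def E
  proof (intro conjI)
    show "simple_graph ?S"
      by (rule simple_graph_image[OF simple_graph_path_graph inj])
    show "verts ?S \<subseteq> verts (complete_bipartite n n)"
      using assms by (simp add: V p[unfolded One_nat_def] complete_bipartite_def)
    show "{{Inl i, Inr j}, {Inl i', Inr j}, {Inl i', Inr j'}} \<subseteq> edges (complete_bipartite n n)"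
      using assms by (auto simp: complete_bipartite_def)
  qed
  show "rainbow c ?S"
    unfolding rainbow_def E using assms by (auto simp: inj_on_def)
qed

text \<open>If \<open>f i' j \<noteq> f i j\<close>, then \<open>free\<close> for the entries
  \<open>(i', j)\<close>, \<open>(i, j)\<close>, \<open>(i, j')\<close> forces
  \<open>f i j' = f i' j\<close> whenever \<open>f i j' \<noteq> f i j\<close>. Row \<open>i\<close>
  then has only two colors.\<close>

lemma three_colors_in_row_imp_columns_constant:
  assumes free: "\<And>i i' j j'. \<lbrakk>i \<in> A; i' \<in> A; j \<in> B; j' \<in> B; i \<noteq> i'; j \<noteq> j'\<rbrakk> \<Longrightarrow>
      \<not> distinct [f i j, f i' j, f i' j']"
    and "i \<in> A" "i' \<in> A" "j1 \<in> B" "j2 \<in> B" "j3 \<in> B" "j \<in> B"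
    and "distinct [f i j1, f i j2, f i j3]"
  shows "f i' j = f i j"
proof (rule ccontr)
  assume ne: "f i' j \<noteq> f i j"
  have two: "f i' j = f i j'" if "j' \<in> B" "f i j' \<noteq> f i j" for j'
    using free[of i' i j j'] assms that ne by force
  show False
    using two[of j1] two[of j2] two[of j3] assms(4-8)
    unfolding distinct_length_2_or_more by metis
qed

text \<open>\<open>colors\<close> expresses that at least three colors occur, in the form that
  yields an entry outside any given pair. Applied to two colors of a non-constant row, it leads to a
  forbidden triple.\<close>

lemma rows_or_columns_constant:
  assumes free: "\<And>i i' j j'. \<lbrakk>i \<in> A; i' \<in> A; j \<in> B; j' \<in> B; i \<noteq> i'; j \<noteq> j'\<rbrakk> \<Longrightarrow>
      \<not> distinct [f i j, f i' j, f i' j']"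
    and colors: "\<And>a b. \<exists>i\<in>A. \<exists>j\<in>B. f i j \<noteq> a \<and> f i j \<noteq> b"
  shows "(\<forall>i\<in>A. \<forall>j\<in>B. \<forall>j'\<in>B. f i j = f i j') \<or> (\<forall>j\<in>B. \<forall>i\<in>A. \<forall>i'\<in>A. f i j = f i' j)"
proof (rule ccontr)
  assume *: "\<not> ?thesis"
  \<comment> \<open>A row with three colors would make all columns constant, against
    \<open>*\<close>.\<close>
  have row: "\<not> distinct [f i j1, f i j2, f i j3]" if "i \<in> A" "j1 \<in> B" "j2 \<in> B" "j3 \<in> B" for i j1 j2 j3
    using three_colors_in_row_imp_columns_constant[of A B f i _ j1 j2 j3] free that * by metis
  obtain r j1 j2 where r: "r \<in> A" "j1 \<in> B" "j2 \<in> B" "f r j1 \<noteq> f r j2"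
    using * by blast
  obtain i j where ij: "i \<in> A" "j \<in> B" "f i j \<noteq> f r j1" "f i j \<noteq> f r j2"
    using colors by blast
  \<comment> \<open>Row \<open>r\<close> has no third color, so the new entry lies in another
    row.\<close>
  have rj: "f r j = f r j1 \<or> f r j = f r j2"
    using row[of r j1 j2 j] r ij by auto
  then have "i \<noteq> r"
    using ij by auto
  \<comment> \<open>A third color at \<open>(i, j1)\<close> or \<open>(i, j2)\<close> would form a
    rainbow triple with \<open>(r, j1)\<close> and \<open>(r, j2)\<close>.\<close>
  have i: "f i j1 = f r j1 \<or> f i j1 = f r j2" "f i j2 = f r j1 \<or> f i j2 = f r j2"
    using free[of i r j1 j2] free[of i r j2 j1] r ij \<open>i \<noteq> r\<close> by auto
  then have "j \<noteq> j1" "j \<noteq> j2"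
    using ij by auto
  have eq: "f i j1 = f i j2"
    using row[of i j1 j2 j] r ij i by auto
  show False
  \<comment> \<open>The color \<open>f i j\<close> differs from both colors of row \<open>r\<close>.
    If \<open>f r j \<noteq> f i j1\<close>, the entries \<open>(r, j)\<close>,
    \<open>(i, j)\<close>, \<open>(i, j1)\<close> are rainbow. Otherwise \<open>(i, j)\<close>,
    \<open>(r, j)\<close> are rainbow together with whichever of \<open>(r, j1)\<close>,
    \<open>(r, j2)\<close> differs in color from \<open>(r, j)\<close>.\<close>
  proof (cases "f r j = f i j1")
    case False
    then show ?thesis
      using free[of r i j j1] r ij i rj \<open>i \<noteq> r\<close> \<open>j \<noteq> j1\<close> by auto
  next
    case True
    then show ?thesis
      using free[of i r j j1] free[of i r j j2] r ij i \<open>i \<noteq> r\<close> \<open>j \<noteq> j1\<close> \<open>j \<noteq> j2\<close> by auto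
  qed
qed

text \<open>The embedding \<open>g\<close> is left general so that the center of the star may lie on
  either side of \<open>K\<^sub>n\<^sub>,\<^sub>n\<close>. It carries the copy of \<open>H\<close>
  in \<open>K\<^sub>1\<^sub>,\<^sub>k\<close> along.\<close>

lemma monochromatic_star:
  fixes c :: "(nat + nat) set \<Rightarrow> nat" and H :: "'h graph"
  assumes H: "\<exists>S. subgraph S (complete_bipartite 1 k) \<and> isomorphic S H"
    and g: "inj g" "g ` verts (complete_bipartite 1 k) \<subseteq> verts G"
      "\<And>j. j < k \<Longrightarrow> {g (Inl 0), g (Inr j)} \<in> edges G \<and> c {g (Inl 0), g (Inr j)} = a"
  shows "\<exists>S. subgraph S G \<and> isomorphic S H \<and> monochromatic c S"
proof -
  obtain S where S: "subgraph S (complete_bipartite 1 k)" "isomorphic S H"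
    using H by blast
  have "simple_graph S"
    using S by (simp add: subgraph_def)
  moreover have "inj_on g (verts S)"
    using g(1) by (rule inj_on_subset) simp
  ultimately have "isomorphic (graph_image g S) S" "simple_graph (graph_image g S)"
    by (simp_all add: isomorphic_graph_image simple_graph_image)
  moreover have "e \<in> edges G \<and> c e = a" if "e \<in> edges (graph_image g S)" for e
  proof -
    from that S(1) obtain j where "j < k" "e = {g (Inl 0), g (Inr j)}"
      by (auto simp: subgraph_def complete_bipartite_def)
    with g(3) show ?thesis by simp
  qed
  moreover have "g ` verts S \<subseteq> verts G"
    using S(1) g(2) unfolding subgraph_def by blast
  ultimately have "subgraph (graph_image g S) G" "monochromatic c (graph_image g S)"
    "isomorphic (graph_image g S) H"
    using isomorphic_trans[OF _ S(2)]
    by (simp_all add: subgraph_def monochromatic_def subset_iff) blast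
  then show ?thesis by blast
qed

lemma edges_complete_bipartite:
  "edges (complete_bipartite m n) = (\<lambda>(i, j). {Inl i, Inr j}) ` ({..<m} \<times> {..<n})"
  by (auto simp: complete_bipartite_def)

lemma doubleton_mem_edges_complete_bipartite [simp]:
  "{Inl i, Inr j} \<in> edges (complete_bipartite m n) \<longleftrightarrow> i < m \<and> j < n"
  "{Inr j, Inl i} \<in> edges (complete_bipartite m n) \<longleftrightarrow> i < m \<and> j < n"
  by (auto simp: complete_bipartite_def doubleton_eq_iff)

lemma verts_complete_bipartite:
  "verts (complete_bipartite m n) = Inl ` {..<m} \<union> Inr ` {..<n}"
  by (simp add: complete_bipartite_def)

lemma gallai_ramsey_property_path_star:
  fixes H :: "'h graph"
  assumes "k \<ge> 3" and H: "\<exists>S. subgraph S (complete_bipartite 1 k) \<and> isomorphic S H"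
  shows "gallai_ramsey_property k (path_graph 4) H n"
  unfolding gallai_ramsey_property_def
proof (intro allI impI)
  fix c :: "(nat + nat) set \<Rightarrow> nat"
  assume c: "exact_edge_coloring k (complete_bipartite n n) c"
  let ?G = "complete_bipartite n n"
  let ?R = "\<exists>S. subgraph S ?G \<and> isomorphic S (path_graph 4) \<and> rainbow c S"
  let ?M = "\<exists>S. subgraph S ?G \<and> isomorphic S H \<and> monochromatic c S"
  define f where "f i j = c {Inl i, Inr j}" for i j
  have range: "(\<lambda>(i, j). f i j) ` ({..<n} \<times> {..<n}) = {1..k}"
    using c by (simp add: exact_edge_coloring_def edges_complete_bipartite image_image f_def case_prod_beta)
  have ?M if "\<not> ?R"
  proof -
    have free: "\<not> distinct [f i j, f i' j, f i' j']"
      if "i \<in> {..<n}" "i' \<in> {..<n}" "j \<in> {..<n}" "j' \<in> {..<n}" "i \<noteq> i'" "j \<noteq> j'" for i i' j j'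
      using rainbow_path_graph_4[of i n i' j j' c] that \<open>\<not> ?R\<close> unfolding f_def by blast
    have colors: "\<exists>i\<in>{..<n}. \<exists>j\<in>{..<n}. f i j \<noteq> a \<and> f i j \<noteq> b" for a b
    proof -
      \<comment> \<open>Since \<open>k \<ge> 3\<close>, the colors 1, 2, 3 all occur, and two values
        cannot cover them.\<close>
      have "\<not> {1, 2, 3} \<subseteq> {a, b}"
        by auto
      then obtain d where "d \<in> {1, 2, 3}" "d \<noteq> a" "d \<noteq> b"
        by blast
      moreover from this have "d \<in> {1..k}"
        using \<open>k \<ge> 3\<close> by auto
      ultimately show ?thesis
        unfolding range[symmetric] by auto
    qed
    have "0 < n"
      using colors by fastforce
    have "(\<forall>i\<in>{..<n}. \<forall>j\<in>{..<n}. \<forall>j'\<in>{..<n}. f i j = f i j') \<or>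
        (\<forall>j\<in>{..<n}. \<forall>i\<in>{..<n}. \<forall>i'\<in>{..<n}. f i j = f i' j)"
      using free colors by (rule rows_or_columns_constant)
    then show ?M
    proof
      assume rows: "\<forall>i\<in>{..<n}. \<forall>j\<in>{..<n}. \<forall>j'\<in>{..<n}. f i j = f i j'"
      \<comment> \<open>Column 0 already shows all \<open>k\<close> colors, which forces
        \<open>k \<le> n\<close>.\<close>
      have "f i j \<in> (\<lambda>i. f i 0) ` {..<n}" if "i < n" "j < n" for i j
        using rows that \<open>0 < n\<close> by blast
      then have "{1..k} \<subseteq> (\<lambda>i. f i 0) ` {..<n}"
        unfolding range[symmetric] by auto
      then have "k \<le> n"
        using surj_card_le[of "{..<n}" "{1..k}"] by simp
      \<comment> \<open>Row 0 is a monochromatic star centered at \<open>Inl 0\<close>; its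
        \<open>n \<ge> k\<close> leaves make room for
        \<open>K\<^sub>1\<^sub>,\<^sub>k\<close>.\<close>
      have "c {Inl 0, Inr j} = f 0 0" if "j < n" for j
        unfolding f_def[symmetric] using rows that \<open>0 < n\<close> by blast
      then show ?thesis
        using \<open>0 < n\<close> \<open>k \<le> n\<close>
        by (intro monochromatic_star[OF H, where g = id and a = "f 0 0"])
          (auto simp: verts_complete_bipartite)
    next
      assume cols: "\<forall>j\<in>{..<n}. \<forall>i\<in>{..<n}. \<forall>i'\<in>{..<n}. f i j = f i' j"
      have "f i j \<in> (\<lambda>j. f 0 j) ` {..<n}" if "i < n" "j < n" for i j
        using cols that \<open>0 < n\<close> by blast
      then have "{1..k} \<subseteq> (\<lambda>j. f 0 j) ` {..<n}"
        unfolding range[symmetric] by auto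
      then have "k \<le> n"
        using surj_card_le[of "{..<n}" "{1..k}"] by simp
      \<comment> \<open>Exchanging the two sides moves the center to \<open>Inr 0\<close>, whose
        edges form column 0.\<close>
      define g :: "nat + nat \<Rightarrow> nat + nat" where "g = case_sum Inr Inl"
      have g: "g (Inl x) = Inr x" "g (Inr x) = Inl x" for x
        by (simp_all add: g_def)
      have "inj g"
        by (auto simp: inj_def g_def split: sum.splits)
      moreover have "c {Inr 0, Inl i} = f 0 0" if "i < n" for i
        unfolding insert_commute[of _ "Inl i"] f_def[symmetric] using cols that \<open>0 < n\<close> by blast
      ultimately show ?thesis
        using \<open>0 < n\<close> \<open>k \<le> n\<close>
        by (intro monochromatic_star[OF H, where g = g and a = "f 0 0"])
          (auto simp: verts_complete_bipartite g)
    qed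
  qed
  then show "?R \<or> ?M"
    by blast
qed

lemma ex_image_eq_iff_card_le:
  assumes "finite A" "finite B" "B \<noteq> {}"
  shows "(\<exists>f. f ` A = B) \<longleftrightarrow> card B \<le> card A"
proof
  assume "card B \<le> card A"
  then obtain g where g: "g ` B \<subseteq> A" "inj_on g B"
    using card_le_inj[OF assms(2,1)] by blast
  obtain b where "b \<in> B"
    using assms(3) by blast
  \<comment> \<open>Invert the injection \<open>g\<close> on its image; the remaining elements of
    \<open>A\<close> go to the default \<open>b\<close>.\<close>
  let ?f = "\<lambda>x. if x \<in> g ` B then inv_into B g x else b"
  have "?f ` A = B"
  proof
    show "?f ` A \<subseteq> B"
      using \<open>b \<in> B\<close> by (auto simp: inv_into_f_f[OF g(2)])
    show "B \<subseteq> ?f ` A"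
    proof
      fix y assume "y \<in> B"
      then have "g y \<in> A" "?f (g y) = y"
        using g by auto
      then show "y \<in> ?f ` A"
        by (intro image_eqI[where x = "g y"]) simp_all
    qed
  qed
  then show "\<exists>f. f ` A = B"
    by blast
qed (use assms(1) card_image_le in blast)

text \<open>An exact coloring is a surjection from the \<open>m * n\<close> edges onto
  \<open>{1..k}\<close>, which is non-empty as \<open>k \<ge> 1\<close>.\<close>

lemma ex_exact_edge_coloring_iff:
  assumes "k \<ge> 1"
  shows "(\<exists>c. exact_edge_coloring k (complete_bipartite m n) c) \<longleftrightarrow> k \<le> m * n"
proof -
  have "inj_on (\<lambda>(i, j). {Inl i, Inr j}) ({..<m} \<times> {..<n})"
    by (auto simp: inj_on_def doubleton_eq_iff)
  then have "card (edges (complete_bipartite m n)) = m * n"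
    by (simp add: edges_complete_bipartite card_image)
  moreover have "finite (edges (complete_bipartite m n))"
    by (simp add: edges_complete_bipartite)
  ultimately show ?thesis
    using assms by (simp add: exact_edge_coloring_def ex_image_eq_iff_card_le)
qed

text \<open>Identifies the \<open>N\<close> for which \<open>K\<^sub>N\<^sub>,\<^sub>N\<close> has
  enough edges for \<open>k\<close> colors as a half-line with an explicit least element.\<close>

lemma nat_ceiling_sqrt_le_iff: "nat \<lceil>sqrt (real k)\<rceil> \<le> N \<longleftrightarrow> k \<le> N * N"
proof -
  have "nat \<lceil>sqrt (real k)\<rceil> \<le> N \<longleftrightarrow> sqrt (real k) \<le> real N"
    by linarith
  also have "\<dots> \<longleftrightarrow> sqrt (real k) \<le> sqrt (real (N * N))"
    by simp
  also have "\<dots> \<longleftrightarrow> k \<le> N * N"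
    unfolding real_sqrt_le_iff of_nat_le_iff ..
  finally show ?thesis .
qed

theorem theorem4p1:
  fixes k :: nat and H :: "'h graph"
  assumes "k \<ge> 3"
    and "simple_graph H" and "no_isolated H" and "edges H \<noteq> {}"
    and "\<exists>S. subgraph S (complete_bipartite 1 k) \<and> isomorphic S H"
  shows "bgr k (path_graph 4) H = enat (nat \<lceil>sqrt (real k)\<rceil>)"
proof -
  have "k \<ge> 1"
    using assms(1) by simp
  \<comment> \<open>The Ramsey property holds at every \<open>n\<close>, so a candidate
    \<open>N\<close> only has to admit an exact coloring.\<close>
  then have "bgr k (path_graph 4) H = Inf (enat ` {N. nat \<lceil>sqrt (real k)\<rceil> \<le> N})"
    unfolding bgr_def nat_ceiling_sqrt_le_iff
    by (simp add: gallai_ramsey_property_path_star[OF assms(1,5)] ex_exact_edge_coloring_iff)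
  also have "\<dots> = enat (nat \<lceil>sqrt (real k)\<rceil>)"
    by (rule Inf_eqI) auto
  finally show ?thesis .
qed

end
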